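(* Let $D$ be a positive nonsquare integer such that the equation $x^2-Dy^2=4$ is solvable in odd integers $x,y$, and let $\varepsilon=x_1+y_1\sqrt{D}$ be the minimal positive solution of $x^2-Dy^2=4$. Let $(x,y)$ be a positive integer solution of $x^2-Dy^2=4$ with $y=p^ny'$, where $p$ is a prime not dividing $D$, $n$ is a positive integer and $y'$ is a positive integer. If every prime divisor of $y'$ divides $D$, then $$\frac{x+y\sqrt{D}}{2}\in\left\{\frac{\varepsilon}{2},\ \left(\frac{\varepsilon}{2}\right)^2,\ \left(\frac{\varepsilon}{2}\right)^3\right\},$$ except for the case $(x,y,D)=(123,55,5)$.
   Context: The minimal positive solution of $x^2-Dy^2=4$ is the solution $(x_1,y_1)$ in positive integers for which $x_1+y_1\sqrt{D}$ is smallest. *)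

theory Defs
  imports Complex_Main "HOL-Computational_Algebra.Primes" "HOL-Computational_Algebra.Nth_Powers"
begin

definition pos_sol4 :: "int \<Rightarrow> int \<Rightarrow> int \<Rightarrow> bool" where
  "pos_sol4 D x y \<longleftrightarrow> x > 0 \<and> y > 0 \<and> x\<^sup>2 - D * y\<^sup>2 = 4"

definition min_pos_sol4 :: "int \<Rightarrow> int \<Rightarrow> int \<Rightarrow> bool" where
  "min_pos_sol4 D x1 y1 \<longleftrightarrow> pos_sol4 D x1 y1 \<and>
     (\<forall>x y. pos_sol4 D x y \<longrightarrow>
        real_of_int x1 + real_of_int y1 * sqrt (real_of_int D)
          \<le> real_of_int x + real_of_int y * sqrt (real_of_int D))"

end

theory Submission
  imports Defs
begin

text \<open>
  All positive solutions are \<open>x = V\<^sub>k(x1)\<close>, \<open>y = y1 * U\<^sub>k(x1)\<close> for the Lucas sequences with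
  \<open>U\<^sub>1 = 1\<close>, \<open>V\<^sub>1 = x1\<close> and recurrence \<open>s(n+2) = x1 * s(n+1) - s(n)\<close>; the claim is \<open>k \<le> 3\<close>.
  With \<open>z = V\<^sub>t(x1)\<close> one has \<open>U\<^bsub>qt\<^esub>(x1) = U\<^sub>t(x1) * U\<^sub>q(z)\<close>, and for an odd index \<open>q = 2j + 1\<close>
  the number \<open>U\<^sub>q(z)\<close> splits as \<open>(U\<^bsub>j+1\<^esub> + U\<^sub>j) * (U\<^bsub>j+1\<^esub> - U\<^sub>j)\<close>.
  Since \<open>D\<close> divides \<open>z\<^sup>2 - 4\<close>, expanding each factor around \<open>z = 2\<close> and \<open>z = -2\<close> shows
  that for a prime \<open>q > 3\<close> a factor all of whose prime divisors divide \<open>D\<close> can only be \<open>1\<close> or \<open>q\<close>.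
  The prime \<open>p\<close> divides at most one of the two factors, so the other one is at most \<open>q\<close>;
  by growth this happens only for \<open>q = 5\<close>, \<open>z = 3\<close>, which is the exceptional case.
  An index \<open>9l\<close> is treated by \<open>U\<^sub>3(z) = (z - 1) * (z + 1)\<close> modulo \<open>9\<close>. For an even index \<open>k = 2m\<close>,
  the number \<open>V\<^sub>m\<close> is prime to \<open>D\<close>, hence a power of \<open>p\<close>, so (for \<open>p = 2\<close> because
  \<open>D\<close> is \<open>1\<close> modulo \<open>4\<close>) the prime divisors of \<open>U\<^sub>m\<close>
  divide \<open>D\<close>, and this forces \<open>m = 1\<close>.
\<close>

section \<open>Lucas sequences and their identities\<close>

fun lucas_U :: "'a::comm_ring_1 \<Rightarrow> nat \<Rightarrow> 'a" where
  "lucas_U x 0 = 0"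
| "lucas_U x (Suc 0) = 1"
| "lucas_U x (Suc (Suc n)) = x * lucas_U x (Suc n) - lucas_U x n"

fun lucas_V :: "'a::comm_ring_1 \<Rightarrow> nat \<Rightarrow> 'a" where
  "lucas_V x 0 = 2"
| "lucas_V x (Suc 0) = x"
| "lucas_V x (Suc (Suc n)) = x * lucas_V x (Suc n) - lucas_V x n"

text \<open>With t^2 = x^2 - 4, these are the coefficients of (x + t)(V_n + t U_n); the factor 2
  avoids division in the ring.\<close>

lemma lucas_step:
  "2 * lucas_U x (Suc n) = x * lucas_U x n + lucas_V x n"
  "2 * lucas_V x (Suc n) = x * lucas_V x n + (x\<^sup>2 - 4) * lucas_U x n"
proof (induction x n rule: lucas_U.induct)
  case (3 x n)
  {
    case 1
    have "2 * lucas_U x (Suc (Suc (Suc n))) =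
        x * (2 * lucas_U x (Suc (Suc n))) - 2 * lucas_U x (Suc n)"
      by (simp add: algebra_simps)
    also have "\<dots> = x * (x * lucas_U x (Suc n) + lucas_V x (Suc n)) - (x * lucas_U x n + lucas_V x n)"
      by (simp only: 3)
    finally show ?case by (simp add: algebra_simps)
  next
    case 2
    have "2 * lucas_V x (Suc (Suc (Suc n))) =
        x * (2 * lucas_V x (Suc (Suc n))) - 2 * lucas_V x (Suc n)"
      by (simp add: algebra_simps)
    also have "\<dots> = x * (x * lucas_V x (Suc n) + (x\<^sup>2 - 4) * lucas_U x (Suc n))
        - (x * lucas_V x n + (x\<^sup>2 - 4) * lucas_U x n)"
      by (simp only: 3)
    finally show ?case by (simp add: algebra_simps)
  }
qed (auto simp: algebra_simps power2_eq_square)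

text \<open>The form a^2 - x a b + b^2 is invariant under the step (a, b) -> (x a - b, a) and equals
  1 at (1, 0).\<close>

lemma lucas_U_norm:
  "(lucas_U x (Suc n))\<^sup>2 - x * lucas_U x (Suc n) * lucas_U x n + (lucas_U x n)\<^sup>2 = 1"
  by (induction n) (auto simp: algebra_simps power2_eq_square)

lemma lucas_V_eq: "lucas_V x n = 2 * lucas_U x (Suc n) - x * lucas_U x n"
  by (simp only: lucas_step) simp

lemma lucas_pell: "(lucas_V x n)\<^sup>2 - (x\<^sup>2 - 4) * (lucas_U x n)\<^sup>2 = 4"
proof -
  have "(lucas_V x n)\<^sup>2 - (x\<^sup>2 - 4) * (lucas_U x n)\<^sup>2 =
      4 * ((lucas_U x (Suc n))\<^sup>2 - x * lucas_U x (Suc n) * lucas_U x n + (lucas_U x n)\<^sup>2)"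
    unfolding lucas_V_eq by (simp add: algebra_simps power2_eq_square)
  then show ?thesis by (simp only: lucas_U_norm) simp
qed

text \<open>For x = t + 1/t one has V_k = t^k + 1/t^k, so multiplying by V_k shifts the index both
  up and down by k. Hence every k-th term obeys the same recurrence with parameter
  \<open>lucas_V x k\<close>.\<close>

lemma lucas_U_add2: "lucas_U x (n + 2 * k) = lucas_V x k * lucas_U x (n + k) - lucas_U x n"
proof (induction x k arbitrary: n rule: lucas_V.induct)
  case (3 x k)
  have 1: "lucas_V x (Suc k) * lucas_U x (n + k + 2) = lucas_U x (n + 2 * k + 3) + lucas_U x (n + 1)"
    using 3(1)[of "n + 1"] by (simp add: numeral_eq_Suc)
  have 2: "lucas_V x k * lucas_U x (n + k + 2) = lucas_U x (n + 2 * k + 2) + lucas_U x (n + 2)"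
    using 3(2)[of "n + 2"] by (simp add: numeral_eq_Suc)
  have "lucas_V x (Suc (Suc k)) * lucas_U x (n + k + 2) =
     x * (lucas_V x (Suc k) * lucas_U x (n + k + 2)) - lucas_V x k * lucas_U x (n + k + 2)"
    by (simp add: algebra_simps)
  also have "\<dots> = lucas_U x (n + 2 * k + 4) + lucas_U x n"
    unfolding 1 2 by (simp add: numeral_eq_Suc algebra_simps)
  finally show ?case by (simp add: numeral_eq_Suc)
qed (auto simp: algebra_simps)

lemma lucas_V_add2: "lucas_V x (n + 2 * k) = lucas_V x k * lucas_V x (n + k) - lucas_V x n"
proof (induction x k arbitrary: n rule: lucas_V.induct)
  case (3 x k)
  have 1: "lucas_V x (Suc k) * lucas_V x (n + k + 2) = lucas_V x (n + 2 * k + 3) + lucas_V x (n + 1)"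
    using 3(1)[of "n + 1"] by (simp add: numeral_eq_Suc)
  have 2: "lucas_V x k * lucas_V x (n + k + 2) = lucas_V x (n + 2 * k + 2) + lucas_V x (n + 2)"
    using 3(2)[of "n + 2"] by (simp add: numeral_eq_Suc)
  have "lucas_V x (Suc (Suc k)) * lucas_V x (n + k + 2) =
     x * (lucas_V x (Suc k) * lucas_V x (n + k + 2)) - lucas_V x k * lucas_V x (n + k + 2)"
    by (simp add: algebra_simps)
  also have "\<dots> = lucas_V x (n + 2 * k + 4) + lucas_V x n"
    unfolding 1 2 by (simp add: numeral_eq_Suc algebra_simps)
  finally show ?case by (simp add: numeral_eq_Suc)
qed (auto simp: algebra_simps)

lemma lucas_U_mult: "lucas_U x (i * m) = lucas_U x m * lucas_U (lucas_V x m) i"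
proof (induction "lucas_V x m" i rule: lucas_U.induct)
  case (3 i)
  have "lucas_U x (Suc (Suc i) * m) = lucas_V x m * lucas_U x (Suc i * m) - lucas_U x (i * m)"
    using lucas_U_add2[of x "i * m" m] by (simp add: add_ac mult_2)
  then show ?case unfolding 3 by (simp add: algebra_simps)
qed auto

lemma lucas_U_double: "lucas_U x (2 * m) = lucas_U x m * lucas_V x m"
  using lucas_U_add2[of x 0 m] by simp

lemma lucas_V_triple: "lucas_V x (3 * m) = (lucas_V x m) ^ 3 - 3 * lucas_V x m"
proof -
  have "lucas_V x (2 * m) = lucas_V x m * lucas_V x m - 2"
    using lucas_V_add2[of x 0 m] by simp
  moreover have "lucas_V x (3 * m) = lucas_V x m * lucas_V x (2 * m) - lucas_V x m"
    using lucas_V_add2[of x m m] by (simp add: mult_2 numeral_3_eq_3)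
  ultimately show ?thesis by (simp only:) (simp add: algebra_simps power3_eq_cube)
qed

section \<open>Factorization at odd index and congruences for the factors\<close>

text \<open>The two parities feed each other through the recurrence, so one induction treats
  both.\<close>

lemma lucas_U_odd_even:
  "lucas_U x (2 * j + 1) = (lucas_U x (Suc j))\<^sup>2 - (lucas_U x j)\<^sup>2 \<and>
   lucas_U x (2 * j + 2) = lucas_U x (Suc j) * (lucas_U x (Suc (Suc j)) - lucas_U x j)"
proof (induction j)
  case (Suc j)
  have 3: "lucas_U x (2 * Suc j + 1) = x * lucas_U x (2 * j + 2) - lucas_U x (2 * j + 1)"
    and 4: "lucas_U x (2 * Suc j + 2) = x * lucas_U x (2 * Suc j + 1) - lucas_U x (2 * j + 2)"
    by simp_all
  have 5: "lucas_U x (2 * Suc j + 1) = (lucas_U x (Suc (Suc j)))\<^sup>2 - (lucas_U x (Suc j))\<^sup>2"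
    unfolding 3 conjunct1[OF Suc] conjunct2[OF Suc] by (simp add: algebra_simps power2_eq_square)
  have "lucas_U x (2 * Suc j + 2) =
      lucas_U x (Suc (Suc j)) * (lucas_U x (Suc (Suc (Suc j))) - lucas_U x (Suc j))"
    unfolding 4 5 conjunct2[OF Suc] by (simp add: algebra_simps power2_eq_square)
  with 5 show ?case ..
qed auto

text \<open>
  If \<open>x = b\<^sup>2 + 1 / b\<^sup>2\<close>, then \<open>lucas_A x j\<close> is \<open>(b ^ q - 1 / b ^ q) / (b - 1 / b)\<close> with \<open>q = 2 * j + 1\<close>;
  the complementary factor of \<open>lucas_U x q\<close> is \<open>lucas_A (- x) j\<close> up to sign.
\<close>
definition lucas_A :: "'a::comm_ring_1 \<Rightarrow> nat \<Rightarrow> 'a" where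
  "lucas_A x j = lucas_U x (Suc j) + lucas_U x j"

lemma lucas_A_rec [simp]:
  "lucas_A x 0 = 1" "lucas_A x (Suc 0) = x + 1"
  "lucas_A x (Suc (Suc j)) = x * lucas_A x (Suc j) - lucas_A x j"
  by (simp_all add: lucas_A_def algebra_simps)

lemma lucas_A_minus: "lucas_A (- x) j = (-1) ^ j * (lucas_U x (Suc j) - lucas_U x j)"
proof (induction x j rule: lucas_U.induct)
  case (3 x j)
  show ?case unfolding lucas_A_rec 3 by (simp add: algebra_simps)
qed (auto simp: algebra_simps)

lemma abs_lucas_A_minus:
  "\<bar>lucas_A (- x) j\<bar> = \<bar>lucas_U x (Suc j) - lucas_U x j\<bar>" for x :: int
  by (simp add: lucas_A_minus abs_mult power_abs)

lemma lucas_U_odd: "lucas_U x (2 * j + 1) = (-1) ^ j * lucas_A x j * lucas_A (- x) j"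
  for x :: "'a::comm_ring_1"
proof -
  have "(-1) ^ j * (-1 :: 'a) ^ j = 1" by (simp flip: power_mult_distrib)
  then have "(-1) ^ j * lucas_A x j * lucas_A (- x) j =
      lucas_A x j * (lucas_U x (Suc j) - lucas_U x j)"
    unfolding lucas_A_minus by (metis mult.assoc mult.commute mult_1)
  also have "\<dots> = lucas_U x (2 * j + 1)"
    unfolding conjunct1[OF lucas_U_odd_even[of x j]] lucas_A_def
    by (simp add: algebra_simps power2_eq_square)
  finally show ?thesis ..
qed

text \<open>Modulo x - 2 second differences vanish, so the initial values 1, 3 continue as an
  arithmetic progression.\<close>

lemma lucas_A_cong_2: "x - 2 dvd lucas_A x j - (2 * of_nat j + 1)"
  for x :: "'a::comm_ring_1"
proof (induction x j rule: lucas_U.induct)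
  case (3 x j)
  have "lucas_A x (Suc (Suc j)) - (2 * of_nat (Suc (Suc j)) + 1) =
     (x - 2) * lucas_A x (Suc j) + 2 * (lucas_A x (Suc j) - (2 * of_nat (Suc j) + 1))
     - (lucas_A x j - (2 * of_nat j + 1))"
    by (simp add: algebra_simps)
  then show ?case using 3 by (metis dvd_add dvd_diff dvd_mult dvd_triv_left)
qed auto

lemma lucas_A_cong_minus_2: "x + 2 dvd lucas_A x j - (-1) ^ j"
  for x :: "'a::comm_ring_1"
proof (induction x j rule: lucas_U.induct)
  case (3 x j)
  have "lucas_A x (Suc (Suc j)) - (-1) ^ Suc (Suc j) =
     (x + 2) * lucas_A x (Suc j) - 2 * (lucas_A x (Suc j) - (-1) ^ Suc j)
     - (lucas_A x j - (-1) ^ j)"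
    by (simp add: algebra_simps)
  then show ?case using 3 by (metis dvd_diff dvd_mult dvd_triv_left)
qed (auto simp: algebra_simps)

text \<open>This is the expansion to first order around x = 2; the factor 6 clears the denominator
  of the linear coefficient j(j+1)(2j+1)/6.\<close>

lemma lucas_A_cong_square:
  "(x - 2)\<^sup>2 dvd 6 * lucas_A x j
     - (2 * of_nat j + 1) * (6 + (x - 2) * of_nat j * (of_nat j + 1))"
  for x :: "'a::comm_ring_1"
proof (induction x j rule: lucas_U.induct)
  case (3 x j)
  define E where "E i = 6 * lucas_A x i
     - (2 * of_nat i + 1) * (6 + (x - 2) * of_nat i * (of_nat i + 1))" for i
  have "E (Suc (Suc j)) = x * E (Suc j) - E j +
     (x - 2)\<^sup>2 * ((2 * of_nat j + 3) * (of_nat j + 1) * (of_nat j + 2))"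
    unfolding E_def by (simp add: algebra_simps power2_eq_square)
  moreover have "(x - 2)\<^sup>2 dvd E (Suc j)" "(x - 2)\<^sup>2 dvd E j"
    using 3 unfolding E_def by auto
  ultimately have "(x - 2)\<^sup>2 dvd E (Suc (Suc j))"
    by (metis dvd_add dvd_diff dvd_mult dvd_triv_left)
  then show ?case unfolding E_def .
qed (auto simp: algebra_simps)

section \<open>Prime divisors of a factor at prime index\<close>

lemma prime_power_of_unique_prime_dvd:
  fixes c q :: int
  assumes "c \<noteq> 0" "prime q" and "\<And>r. prime r \<Longrightarrow> r dvd c \<Longrightarrow> r = q"
  obtains e where "\<bar>c\<bar> = q ^ e"
proof -
  obtain e d where d: "c = q ^ e * d" "\<not> q dvd d"
    using assms(1,2) by (metis multiplicity_decompose' not_prime_unit)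
  have "is_unit d"
  proof (rule ccontr)
    assume "\<not> is_unit d"
    then obtain r where "prime r" "r dvd d"
      using assms(1) d by (metis mult_zero_right prime_divisor_exists)
    then show False using assms(3)[of r] d by auto
  qed
  then have "\<bar>c\<bar> = q ^ e"
    using d(1) assms(2) by (auto simp: abs_mult power_abs prime_ge_0_int)
  then show ?thesis using that by blast
qed

text \<open>A prime divisor of the factor divides (x - 2)(x + 2). It cannot divide x + 2, modulo
  which the factor is 1 or -1, and modulo x - 2 the factor is q = 2j + 1. So only q remains, and the
  first-order expansion excludes q^2.\<close>

lemma lucas_A_prime_index:
  fixes x D :: int
  assumes q: "prime (2 * j + 1)" "j \<ge> 2"
    and D: "D dvd x\<^sup>2 - 4"
    and primes: "\<And>r. prime r \<Longrightarrow> r dvd lucas_A x j \<Longrightarrow> r dvd D"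
    and nz: "lucas_A x j \<noteq> 0"
  shows "\<bar>lucas_A x j\<bar> = 1 \<or> \<bar>lucas_A x j\<bar> = 2 * int j + 1"
proof -
  let ?q = "2 * int j + 1"
  have pq: "prime ?q"
    using q(1) by (metis of_nat_1 of_nat_add of_nat_mult of_nat_numeral prime_nat_int_transfer)
  have two: "r dvd x - 2" if "prime r" "r dvd lucas_A x j" for r
  proof -
    have "r dvd (x - 2) * (x + 2)"
      using primes[OF that] D by (auto simp: algebra_simps power2_eq_square intro: dvd_trans)
    moreover have "\<not> r dvd x + 2"
    proof
      assume "r dvd x + 2"
      then have "r dvd lucas_A x j - (-1) ^ j" using lucas_A_cong_minus_2 dvd_trans by blast
      then have "r dvd (-1) ^ j" using that(2) by (simp add: dvd_diff_right_iff)
      then show False using that(1) by (meson is_unit_power_iff dvd_minus_iff dvd_refl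
            dvd_trans not_prime_unit prime_dvd_power dvd_unit_imp_unit minus_dvd_iff)
    qed
    ultimately show ?thesis using that(1) prime_dvd_multD by blast
  qed
  have only: "r = ?q" if "prime r" "r dvd lucas_A x j" for r
  proof -
    have "r dvd lucas_A x j - ?q"
      using two[OF that] lucas_A_cong_2[of x j] by (auto intro: dvd_trans)
    then have "r dvd ?q" using that(2) by (simp add: dvd_diff_right_iff)
    then show ?thesis using pq that(1) primes_dvd_imp_eq by blast
  qed
  obtain e where e: "\<bar>lucas_A x j\<bar> = ?q ^ e"
    using prime_power_of_unique_prime_dvd[OF nz pq only] by blast
  have "\<not> ?q\<^sup>2 dvd lucas_A x j"
  proof
    assume sq: "?q\<^sup>2 dvd lucas_A x j"
    then have qd: "?q dvd x - 2" using two pq by (meson dvd_power dvd_trans pos2)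
    then obtain t where t: "x - 2 = ?q * t" ..
    have "?q\<^sup>2 dvd (x - 2)\<^sup>2" using qd by simp
    then have "?q\<^sup>2 dvd 6 * lucas_A x j - ?q * (6 + (x - 2) * int j * (int j + 1))"
      using lucas_A_cong_square[of x j] by (auto intro: dvd_trans)
    then have "?q\<^sup>2 dvd ?q * (6 + (x - 2) * int j * (int j + 1))"
      using sq by (metis dvd_diff_right_iff dvd_mult)
    \<comment> \<open>One factor q is cancelled; since q divides \<open>x - 2\<close>, it would
      divide 6, impossible for a prime q >= 5.\<close>
    then have "?q dvd 6 + (x - 2) * int j * (int j + 1)"
      by (simp add: power2_eq_square)
    then have "?q dvd 6" unfolding t by (metis dvd_add_left_iff dvd_mult2 dvd_triv_left)
    then have "?q dvd 2 * 3" by simp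
    then have "?q dvd 2 \<or> ?q dvd 3" using pq prime_dvd_multD by blast
    then have "?q \<le> 3" by (auto dest: zdvd_imp_le)
    then show False using q(2) by simp
  qed
  then have "e < 2" using e by (metis dvd_abs_iff le_imp_power_dvd not_le)
  then show ?thesis using e by (auto simp: less_2_cases_iff)
qed

section \<open>Growth estimates\<close>

lemma lucas_diff_growth:
  fixes x :: int
  assumes "x \<ge> 3"
  shows "lucas_U x (Suc j) - lucas_U x j > 0 \<and> lucas_U x j \<ge> 0 \<and>
    lucas_U x (Suc (Suc j)) - lucas_U x (Suc j) \<ge> 2 * (lucas_U x (Suc j) - lucas_U x j)"
proof (induction j)
  case (Suc j)
  define B where "B i = lucas_U x (Suc i) - lucas_U x i" for i
  have IH: "B j > 0" "lucas_U x j \<ge> 0" "B (Suc j) \<ge> 2 * B j"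
    using Suc by (auto simp: B_def)
  have "B (Suc (Suc j)) = x * B (Suc j) - B j" by (simp add: B_def algebra_simps)
  moreover have "x * B (Suc j) \<ge> 3 * B (Suc j)" using assms IH by (intro mult_right_mono) auto
  ultimately have "B (Suc (Suc j)) \<ge> 2 * B (Suc j)" using IH by linarith
  moreover have "lucas_U x (Suc j) \<ge> 0" using IH by (simp add: B_def)
  moreover have "B (Suc j) > 0" using IH by linarith
  ultimately show ?case unfolding B_def by blast
qed (use assms in auto)

text \<open>The difference at least doubles while the right side grows by 2; at j = 3 it is at least
  2 * 5 > 7.\<close>

lemma lucas_diff_gt_index:
  fixes x :: int
  assumes x: "x \<ge> 3" and j: "j \<ge> 3"
  shows "lucas_U x (Suc j) - lucas_U x j > 2 * int j + 1"
  using j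
proof (induction j rule: dec_induct)
  case base
  have "lucas_U x 3 - lucas_U x 2 = x * (x - 1) - 1"
    by (simp add: numeral_eq_Suc algebra_simps)
  moreover have "x * (x - 1) \<ge> 3 * 2" using x by (intro mult_mono) auto
  ultimately have "lucas_U x 3 - lucas_U x 2 \<ge> 5" by linarith
  then show ?case using lucas_diff_growth[OF x, of 2] by (simp add: numeral_eq_Suc)
next
  case (step j)
  then show ?case using lucas_diff_growth[OF x, of j] by simp
qed

text \<open>At j = 2 the difference is x^2 - x - 1, which for x >= 3 equals 5 only at x = 3. This
  equality is the source of the exceptional solution.\<close>

lemma lucas_diff_ge_index:
  fixes x :: int
  assumes x: "x \<ge> 3" and j: "j \<ge> 2"
  shows "lucas_U x (Suc j) - lucas_U x j \<ge> 2 * int j + 1"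
    and "lucas_U x (Suc j) - lucas_U x j = 2 * int j + 1 \<Longrightarrow> x = 3 \<and> j = 2"
proof -
  have 2: "lucas_U x 3 - lucas_U x 2 = x * (x - 1) - 1"
    by (simp add: numeral_eq_Suc algebra_simps)
  have 3: "x * (x - 1) \<ge> 3 * 2" using x by (intro mult_mono) auto
  show "lucas_U x (Suc j) - lucas_U x j \<ge> 2 * int j + 1"
  proof (cases "j = 2")
    case True then show ?thesis using 2 3 by (simp add: numeral_eq_Suc)
  next
    case False then show ?thesis using lucas_diff_gt_index[OF x, of j] j by simp
  qed
  show "x = 3 \<and> j = 2" if eq: "lucas_U x (Suc j) - lucas_U x j = 2 * int j + 1"
  proof (cases "j = 2")
    case True
    have "x < 4"
    proof (rule ccontr)
      assume "\<not> x < 4"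
      then have "x * (x - 1) \<ge> 4 * 3" by (intro mult_mono) auto
      then show False using eq True 2 by (simp add: numeral_eq_Suc)
    qed
    then show ?thesis using True x by simp
  next
    case False then show ?thesis using lucas_diff_gt_index[OF x, of j] j eq by simp
  qed
qed

lemma lucas_A_gt_index:
  fixes x :: int
  assumes x: "x \<ge> 3" and j: "j \<ge> 2"
  shows "lucas_A x j > 2 * int j + 1"
proof -
  obtain i where i: "j = Suc i" using j by (cases j) auto
  have "lucas_U x j > 0" using lucas_diff_growth[OF x, of i] i by simp
  then show ?thesis using lucas_diff_ge_index(1)[OF x j] by (simp add: lucas_A_def)
qed

lemma lucas_V_growth:
  fixes x :: int
  assumes "x \<ge> 3"
  shows "lucas_V x (Suc n) > lucas_V x n \<and> lucas_V x n > 0"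
proof (induction n)
  case (Suc n)
  have "x * lucas_V x (Suc n) \<ge> 3 * lucas_V x (Suc n)"
    using assms Suc by (intro mult_right_mono) auto
  then show ?case using Suc unfolding lucas_V.simps by linarith
qed (use assms in auto)

lemma lucas_V_strict_mono: "(x :: int) \<ge> 3 \<Longrightarrow> strict_mono (lucas_V x)"
  using lucas_V_growth by (auto simp: strict_mono_Suc_iff)

lemma lucas_V_ge_3:
  assumes "(x :: int) \<ge> 3" "m > 0" shows "lucas_V x m \<ge> 3"
proof -
  have "lucas_V x 1 \<le> lucas_V x m"
    using strict_mono_less_eq[OF lucas_V_strict_mono[OF assms(1)], of 1 m] assms(2) by simp
  then show ?thesis using assms by simp
qed

section \<open>Separating the two factors at prime index\<close>

lemma even_lucas_U: "even (lucas_U x n) \<longleftrightarrow> (if even x then even n else 3 dvd n)"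
  for x :: int
proof (induction x n rule: lucas_U.induct)
  case (3 x n)
  then show ?case by (auto, presburger+)
qed auto

text \<open>An odd common prime divides the sum and the difference of two consecutive terms, hence
  both terms, against \<open>lucas_U_norm\<close>. The prime 2 is governed by the parity pattern of
  the sequence.\<close>

lemma prime_dvd_lucas_A_both:
  fixes p x :: int
  assumes "prime p" "p dvd lucas_A x j" "p dvd lucas_A (- x) j"
  shows "3 dvd 2 * j + 1"
proof (cases "p = 2")
  case True
  then have "even (lucas_U x (2 * j + 1))"
    unfolding lucas_U_odd using assms by simp
  then show ?thesis unfolding even_lucas_U by (auto split: if_splits)
next
  case False
  have "p dvd \<bar>lucas_A (- x) j\<bar>" using assms(3) by simp
  then have A: "p dvd lucas_U x (Suc j) + lucas_U x j" "p dvd lucas_U x (Suc j) - lucas_U x j"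
    using assms(2) unfolding abs_lucas_A_minus by (simp_all add: lucas_A_def)
  have "p dvd 2 * lucas_U x (Suc j)" "p dvd 2 * lucas_U x j"
    using dvd_add[OF A] dvd_diff[OF A] by (simp_all add: algebra_simps)
  moreover have "\<not> p dvd 2" using primes_dvd_imp_eq[OF assms(1), of 2] False by auto
  ultimately have "p dvd lucas_U x (Suc j)" "p dvd lucas_U x j"
    using assms(1) prime_dvd_multD by blast+
  then have "p dvd (lucas_U x (Suc j))\<^sup>2 - x * lucas_U x (Suc j) * lucas_U x j + (lucas_U x j)\<^sup>2"
    by (simp add: power2_eq_square)
  then have "p dvd 1" by (simp only: lucas_U_norm)
  then show ?thesis using assms(1) not_prime_unit by blast
qed

lemma lucas_U_prime_index:
  fixes z D p :: int
  assumes z: "z \<ge> 3" and D: "D dvd z\<^sup>2 - 4"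
    and q: "prime (2 * j + 1)" "j \<ge> 2" and p: "prime p"
    and primes: "\<And>r. prime r \<Longrightarrow> r dvd lucas_U z (2 * j + 1) \<Longrightarrow> r = p \<or> r dvd D"
  shows "z = 3 \<and> j = 2"
    and "\<exists>r. prime r \<and> r dvd lucas_U z (2 * j + 1) \<and> \<not> r dvd D"
proof -
  have dvd: "lucas_A z j dvd lucas_U z (2 * j + 1)" "lucas_A (- z) j dvd lucas_U z (2 * j + 1)"
    unfolding lucas_U_odd by simp_all
  have gt: "lucas_A z j > 2 * int j + 1" using lucas_A_gt_index[OF z q(2)] .
  \<comment> \<open>The sum factor exceeds q = 2j + 1, so it is neither 1 nor q and contains a prime
    outside D; by \<open>primes\<close> this prime is p.\<close>
  have "\<exists>r. prime r \<and> r dvd lucas_A z j \<and> \<not> r dvd D"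
    using lucas_A_prime_index[OF q D] gt by fastforce
  then obtain r where r: "prime r" "r dvd lucas_A z j" "\<not> r dvd D" by blast
  then show "\<exists>r. prime r \<and> r dvd lucas_U z (2 * j + 1) \<and> \<not> r dvd D"
    using dvd(1) dvd_trans by blast
  have "r = p" using r primes dvd(1) dvd_trans by blast
  have "\<not> 3 dvd 2 * j + 1"
    using q by (auto simp: prime_nat_iff)
  then have "\<not> p dvd lucas_A (- z) j"
    using prime_dvd_lucas_A_both[OF p] r(2) \<open>r = p\<close> by blast
  then have pr: "s dvd D" if "prime s" "s dvd lucas_A (- z) j" for s
    using that primes dvd(2) dvd_trans by blast
  have B: "\<bar>lucas_A (- z) j\<bar> = lucas_U z (Suc j) - lucas_U z j"
    using lucas_diff_growth[OF z, of j] by (simp add: abs_lucas_A_minus)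
  have ge: "lucas_U z (Suc j) - lucas_U z j \<ge> 2 * int j + 1"
    using lucas_diff_ge_index(1)[OF z q(2)] .
  have "lucas_A (- z) j \<noteq> 0" using B ge by auto
  \<comment> \<open>The difference factor is free of p, hence 1 or q; being at least q, it is in the
    equality case of the growth bound.\<close>
  then have "\<bar>lucas_A (- z) j\<bar> = 1 \<or> \<bar>lucas_A (- z) j\<bar> = 2 * int j + 1"
    using lucas_A_prime_index[OF q, of D "- z"] D pr by simp
  then show "z = 3 \<and> j = 2"
    using lucas_diff_ge_index(2)[OF z q(2)] ge q(2) unfolding B by auto
qed

section \<open>Primes outside D for composite index\<close>

lemma dvd_lucas_V_square_minus_4:
  fixes x D :: int
  assumes "D dvd x\<^sup>2 - 4" shows "D dvd (lucas_V x m)\<^sup>2 - 4"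
proof -
  have "(lucas_V x m)\<^sup>2 - 4 = (x\<^sup>2 - 4) * (lucas_U x m)\<^sup>2"
    using lucas_pell[of x m] by simp
  then show ?thesis using assms by simp
qed

lemma prime_dvd_odd_not_dvd:
  fixes z D r :: int
  assumes "odd D" "D dvd z\<^sup>2 - 4" "prime r" "r dvd z"
  shows "\<not> r dvd D"
proof
  assume r: "r dvd D"
  have "r dvd z\<^sup>2 - 4" "r dvd z\<^sup>2" using r assms by (auto simp: power2_eq_square)
  then have "r dvd 2 * 2" by (simp add: dvd_diff_right_iff)
  then have "r dvd 2" using assms(3) prime_dvd_multD by blast
  then have "r = 2" using assms(3) by (simp add: primes_dvd_imp_eq)
  then show False using r assms(1) by simp
qed

lemma exists_prime_dvd_int:
  fixes z :: int assumes "z \<ge> 2" obtains r where "prime r" "r dvd z"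
proof -
  have "\<not> is_unit z" "z \<noteq> 0" using assms by auto
  then show ?thesis using that prime_divisor_exists by blast
qed

text \<open>If m = q t, then U_q(V_t) divides U_m, so it suffices to treat a prime index q.\<close>

lemma lucas_U_primitive_prime:
  fixes x D :: int
  assumes x: "x \<ge> 3" and D: "odd D" "D dvd x\<^sup>2 - 4" and m: "m \<ge> 2"
  shows "\<exists>r. prime r \<and> r dvd lucas_U x m \<and> \<not> r dvd D"
proof -
  obtain q where q: "prime q" "q dvd m" using m prime_factor_nat[of m] by auto
  then obtain t where t: "m = q * t" by blast
  define z where "z = lucas_V x t"
  have "t > 0" using m t by (cases t) auto
  then have z: "z \<ge> 3" unfolding z_def using lucas_V_ge_3[OF x] by blast
  have Dz: "D dvd z\<^sup>2 - 4" unfolding z_def using dvd_lucas_V_square_minus_4 D by blast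
  have "\<exists>r. prime r \<and> r dvd lucas_U z q \<and> \<not> r dvd D"
  proof -
    have "q \<ge> 2" using q(1) prime_ge_2_nat by blast
    then consider "q = 2" | "q = 3" | "q > 3" by linarith
    then show ?thesis
    proof cases
      case 1
      obtain r where "prime r" "r dvd z" using exists_prime_dvd_int[of z] z by auto
      then show ?thesis
        using prime_dvd_odd_not_dvd[OF D(1) Dz] 1 by (auto simp: numeral_2_eq_2)
    next
      case 2
      have U3: "lucas_U z 3 = (z - 1) * (z + 1)" by (simp add: numeral_3_eq_3 algebra_simps)
      show ?thesis
      proof (rule ccontr)
        assume neg: "\<not> ?thesis"
        \<comment> \<open>The product \<open>(z - 1) * (z + 1)\<close> exceeds z^2 - 4 by 3. Both
          its factors exceed 1, so both would be multiples of 3, although they differ by 2.\<close>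
        have only: "r = 3" if "prime r" "r dvd (z - 1) * (z + 1)" for r
        proof -
          have "r dvd z\<^sup>2 - 4" using neg that 2 U3 Dz dvd_trans by metis
          then have "r dvd (z - 1) * (z + 1) - (z\<^sup>2 - 4)" using that(2) by (rule dvd_diff[rotated])
          then have "r dvd 3" by (simp add: algebra_simps power2_eq_square)
          then show ?thesis using that(1) by (simp add: primes_dvd_imp_eq)
        qed
        obtain r where "prime r" "r dvd z - 1" using exists_prime_dvd_int[of "z - 1"] z by auto
        then have a: "3 dvd z - 1" using only[of r] by auto
        obtain r where "prime r" "r dvd z + 1" using exists_prime_dvd_int[of "z + 1"] z by auto
        then have b: "3 dvd z + 1" using only[of r] by auto
        show False using a b by presburger
      qed
    next
      case 3
      then have "odd q" using q(1) prime_odd_nat by simp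
      then obtain j where j: "q = 2 * j + 1" by (auto elim: oddE)
      show ?thesis
      proof (rule ccontr)
        assume "\<not> ?thesis"
        \<comment> \<open>Under the negation every prime divisor divides D, so p may be any prime; 2
          is an arbitrary choice.\<close>
        then show False
          using lucas_U_prime_index(2)[OF z Dz, of j 2] q(1) 3 unfolding j by auto
      qed
    qed
  qed
  moreover have "lucas_U z q dvd lucas_U x m"
    unfolding t lucas_U_mult z_def by simp
  ultimately show ?thesis using dvd_trans by blast
qed

text \<open>Since w is 1 or 2 modulo 3, the cubic is -2 or 2 modulo 9. For w = V_l it is
  V_{3l}.\<close>

lemma nine_not_dvd_lucas_V_triple:
  fixes w :: int
  assumes "3 dvd w\<^sup>2 - 4"
  shows "\<not> 9 dvd w ^ 3 - 3 * w - 1" "\<not> 9 dvd w ^ 3 - 3 * w + 1"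
proof -
  have "\<not> 3 dvd w"
  proof
    assume "3 dvd w"
    then have "3 dvd w\<^sup>2" by (simp add: power2_eq_square)
    then have "(3 :: int) dvd 4" using assms by (simp add: dvd_diff_right_iff)
    then show False by simp
  qed
  then have "w = 3 * (w div 3) + 1 \<or> w = 3 * (w div 3) + 2" by presburger
  then consider s where "w = 3 * s + 1" | s where "w = 3 * s + 2" by blast
  then obtain u where "w ^ 3 - 3 * w = 9 * u - 2 \<or> w ^ 3 - 3 * w = 9 * u + 2"
  proof cases
    case (1 s)
    have "w ^ 3 - 3 * w = 9 * (3 * s ^ 3 + 3 * s\<^sup>2) - 2"
      unfolding 1 by (simp add: algebra_simps power3_eq_cube power2_eq_square)
    then show ?thesis using that by blast
  next
    case (2 s)
    have "w ^ 3 - 3 * w = 9 * (3 * s ^ 3 + 6 * s\<^sup>2 + 3 * s) + 2"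
      unfolding 2 by (simp add: algebra_simps power3_eq_cube power2_eq_square)
    then show ?thesis using that by blast
  qed
  then show "\<not> 9 dvd w ^ 3 - 3 * w - 1" "\<not> 9 dvd w ^ 3 - 3 * w + 1"
    by presburger+
qed

text \<open>Index 3 is permitted, so the obstruction takes two factors 3: the outer one splits off
  (z - 1)(z + 1), the inner one makes z a cubic in w with restricted residues modulo 9.\<close>

lemma lucas_U_nine:
  fixes x D p :: int
  assumes x: "x \<ge> 3" and D: "D dvd x\<^sup>2 - 4" and l: "l > 0" and p: "prime p"
  shows "\<exists>r. prime r \<and> r dvd lucas_U x (9 * l) \<and> r \<noteq> p \<and> \<not> r dvd D"
proof (rule ccontr)
  assume neg: "\<not> ?thesis"
  define w where "w = lucas_V x l"
  define z where "z = lucas_V x (3 * l)"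
  have z_eq: "z = w ^ 3 - 3 * w" unfolding z_def w_def by (rule lucas_V_triple)
  have Dw: "D dvd w\<^sup>2 - 4" and Dz: "D dvd z\<^sup>2 - 4"
    unfolding w_def z_def using dvd_lucas_V_square_minus_4 D by blast+
  have w: "w \<ge> 3" unfolding w_def using lucas_V_ge_3 x l by blast
  have "w * (w * w - 3) \<ge> 3 * (3 * 3 - 3)"
    using w by (intro mult_mono diff_mono) (auto intro: order_trans[OF _ mult_mono[of 3 w 3 w]])
  then have z: "z \<ge> 18" by (simp add: z_eq power3_eq_cube algebra_simps)
  have "even z" by (simp add: z_eq)
  have "lucas_U x (3 * (3 * l)) = lucas_U x (3 * l) * lucas_U z 3"
    unfolding z_def by (rule lucas_U_mult)
  moreover have "lucas_U z 3 = (z - 1) * (z + 1)" by (simp add: numeral_3_eq_3 algebra_simps)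
  ultimately have dvd: "(z - 1) * (z + 1) dvd lucas_U x (9 * l)" by simp
  \<comment> \<open>The neighbours of the even number z are coprime, so p misses one of them, called
    c below.\<close>
  have "\<not> (p dvd z - 1 \<and> p dvd z + 1)"
  proof
    assume "p dvd z - 1 \<and> p dvd z + 1"
    then have "p dvd (z + 1) - (z - 1)" using dvd_diff by blast
    then have "p = 2" using p by (simp add: primes_dvd_imp_eq)
    then show False using \<open>even z\<close> \<open>p dvd z - 1 \<and> p dvd z + 1\<close> by simp
  qed
  then obtain c where c: "c = z - 1 \<or> c = z + 1" "\<not> p dvd c" by blast
  have cdvd: "c dvd (z - 1) * (z + 1)" using c(1) by auto
  have rD: "r dvd D" if "prime r" "r dvd c" for r
    using neg that c(2) dvd cdvd dvd_trans by metis
  have only: "r = 3" if "prime r" "r dvd c" for r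
  proof -
    have "r dvd (z - 1) * (z + 1) - (z\<^sup>2 - 4)"
      using rD[OF that] Dz that(2) cdvd by (meson dvd_diff dvd_trans)
    then have "r dvd 3" by (simp add: algebra_simps power2_eq_square)
    then show ?thesis using that(1) by (simp add: primes_dvd_imp_eq)
  qed
  \<comment> \<open>A power of 3 of this size is a multiple of 9.\<close>
  have "c \<ge> 17" using c z by auto
  then obtain e where e: "c = 3 ^ e"
    using prime_power_of_unique_prime_dvd[of c 3] only by auto
  have "e \<ge> 2"
  proof (rule ccontr)
    assume "\<not> e \<ge> 2"
    then have "e = 0 \<or> e = 1" by linarith
    then show False using e \<open>c \<ge> 17\<close> by auto
  qed
  then have "3 ^ 2 dvd c" unfolding e by (rule le_imp_power_dvd)
  then have nine: "9 dvd c" by simp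
  then have "3 dvd c" by presburger
  then have "3 dvd w\<^sup>2 - 4" using rD[of 3] Dw dvd_trans by simp blast
  then show False using nine_not_dvd_lucas_V_triple nine c(1) unfolding z_eq by blast
qed

section \<open>Bound on the index\<close>

text \<open>In the application \<open>(x, y)\<close> is the minimal solution, and
  \<open>y * lucas_U x k\<close> is the second coordinate of the given one.\<close>

lemma index_le_3:
  fixes x y D p :: int
  assumes xy: "x \<ge> 3" "x\<^sup>2 - D * y\<^sup>2 = 4" and D: "D mod 4 = 1" and k: "k > 0" and p: "prime p"
    and primes: "\<And>r. prime r \<Longrightarrow> r dvd y * lucas_U x k \<Longrightarrow> r = p \<or> r dvd D"
  shows "k \<le> 3 \<or> k = 5 \<and> x = 3"
proof (rule ccontr)
  assume "\<not> ?thesis"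
  then have k3: "k > 3" and k5: "\<not> (k = 5 \<and> x = 3)" by auto
  have D1: "odd D" using D by presburger
  have "x\<^sup>2 - 4 = D * y\<^sup>2" using xy by simp
  then have D2: "D dvd x\<^sup>2 - 4" by simp
  have primesU: "r = p \<or> r dvd D" if "prime r" "r dvd lucas_U x k" for r
    using primes that by simp
  show False
  proof (cases "even k")
    case True
    then obtain m where m: "k = 2 * m" by blast
    define v where "v = lucas_V x m"
    have v: "v \<ge> 3" unfolding v_def using lucas_V_ge_3 xy(1) m k by simp
    have Uk: "lucas_U x k = lucas_U x m * v" unfolding m v_def by (rule lucas_U_double)
    have Dv: "D dvd v\<^sup>2 - 4" unfolding v_def using dvd_lucas_V_square_minus_4 D2 by blast
    \<comment> \<open>As v is prime to D, its only prime divisor is p.\<close>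
    have vp: "r = p" if "prime r" "r dvd v" for r
      using prime_dvd_odd_not_dvd[OF D1 Dv that] primesU[OF that(1)] that(2) Uk by auto
    have "m \<ge> 2" using m k3 by simp
    then obtain s where s: "prime s" "s dvd lucas_U x m" "\<not> s dvd D"
      using lucas_U_primitive_prime[OF xy(1) D1 D2] by blast
    moreover have "s dvd lucas_U x k" unfolding Uk using s(2) by simp
    ultimately have "p dvd lucas_U x m" using primesU[of s] by blast
    obtain r where "prime r" "r dvd v" using exists_prime_dvd_int[of v] v by auto
    then have "p dvd v" using vp by blast
    \<comment> \<open>The pair (v, b') is again a solution; p divides both coordinates, hence p
      divides 4.\<close>
    define b' where "b' = y * lucas_U x m"
    have norm: "v\<^sup>2 - D * b'\<^sup>2 = 4"
      using lucas_pell[of x m] xy(2) unfolding v_def b'_def \<open>x\<^sup>2 - 4 = D * y\<^sup>2\<close>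
      by (simp add: power_mult_distrib mult.assoc)
    have "p dvd b'" unfolding b'_def using \<open>p dvd lucas_U x m\<close> by simp
    then have "p dvd v\<^sup>2 - D * b'\<^sup>2" using \<open>p dvd v\<close> by (simp add: power2_eq_square)
    then have "p dvd 2 * 2" using norm by simp
    then have "p dvd 2" using p prime_dvd_multD by blast
    then have "p = 2" using p by (simp add: primes_dvd_imp_eq)
    then obtain a b where a: "v = 2 * a" and b: "b' = 2 * b" using \<open>p dvd v\<close> \<open>p dvd b'\<close> by blast
    \<comment> \<open>Halving gives a^2 - D b^2 = 1. Here a is even because v has no prime divisor
      but 2, so D = 1 modulo 4 yields b^2 = -1 modulo 4, which is impossible.\<close>
    have "a \<ge> 2" using v a by simp
    then obtain r where r: "prime r" "r dvd a" using exists_prime_dvd_int by blast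
    then have "even a" using vp[of r] a \<open>p = 2\<close> by auto
    then obtain c where c: "a = 2 * c" by blast
    obtain d where d: "D = 4 * d + 1" using D by (metis mult_div_mod_eq)
    have eq: "4 * c\<^sup>2 - (4 * d + 1) * b\<^sup>2 = 1"
      using norm unfolding a b c d by (simp add: power_mult_distrib algebra_simps)
    moreover have "even (4 * c\<^sup>2 - (4 * d + 1) * b\<^sup>2) \<longleftrightarrow> even b" by simp
    ultimately have "odd b" by simp
    then obtain f where f: "b = 2 * f + 1" by (elim oddE)
    have "4 * (c\<^sup>2 - d * b\<^sup>2 - f\<^sup>2 - f) = 2"
      using eq unfolding f by (simp add: algebra_simps power2_eq_square)
    then show False by presburger
  next
    case odd: False
    \<comment> \<open>An odd k > 3 without a prime factor above 3 is a power of 3.\<close>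
    have "(\<exists>q. prime q \<and> q > 3 \<and> q dvd k) \<or> 9 dvd k"
    proof (cases "3 dvd k")
      case True
      then obtain t where t: "k = 3 * t" by blast
      then obtain q where q: "prime q" "q dvd t" using k3 prime_factor_nat[of t] by auto
      then have "q \<noteq> 2" using odd t by auto
      then have "q = 3 \<or> q > 3" using prime_ge_2_nat[OF q(1)] by linarith
      then show ?thesis using q t by auto
    next
      case False
      obtain q where q: "prime q" "q dvd k" using k3 prime_factor_nat[of k] by auto
      then have "q \<noteq> 2" "q \<noteq> 3" using odd False by auto
      then show ?thesis using q prime_ge_2_nat[OF q(1)] by (intro disjI1 exI[of _ q]) auto
    qed
    then show False
    proof
      assume "9 dvd k"
      then obtain l where "k = 9 * l" by blast
      then show False using lucas_U_nine[OF xy(1) D2 _ p, of l] k primesU by auto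
    next
      assume "\<exists>q. prime q \<and> q > 3 \<and> q dvd k"
      then obtain q t where q: "prime q" "q > 3" and t: "k = q * t" by blast
      have "odd q" using odd t by simp
      then obtain j where j: "q = 2 * j + 1" by (elim oddE)
      define z where "z = lucas_V x t"
      have "t > 0" using k t by (cases t) auto
      then have z: "z \<ge> 3" unfolding z_def using lucas_V_ge_3 xy(1) by blast
      have Dz: "D dvd z\<^sup>2 - 4" unfolding z_def using dvd_lucas_V_square_minus_4 D2 by blast
      have "lucas_U x k = lucas_U x t * lucas_U z q" unfolding t z_def by (rule lucas_U_mult)
      then have "r = p \<or> r dvd D" if "prime r" "r dvd lucas_U z (2 * j + 1)" for r
        using that primesU j by simp
      then have *: "z = 3 \<and> j = 2"
        using lucas_U_prime_index(1)[OF z Dz _ _ p, of j] q j by auto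
      \<comment> \<open>V increases strictly from V_1 = x >= 3, so V_t = 3 leaves only t = 1 and x =
        3, that is, k = 5.\<close>
      have "t = 1"
      proof (rule ccontr)
        assume "t \<noteq> 1"
        then have "lucas_V x 1 < lucas_V x t"
          using \<open>t > 0\<close> strict_monoD[OF lucas_V_strict_mono[OF xy(1)], of 1 t] by simp
        then show False using * xy(1) unfolding z_def by simp
      qed
      then show False using * k5 t j unfolding z_def by simp
    qed
  qed
qed

section \<open>Positive solutions as Lucas numbers\<close>

text \<open>Descent on y: dividing by the minimal solution gives a solution with smaller second
  coordinate and index lower by one.\<close>

lemma pos_sol4_lucas:
  assumes D: "D > 0" "odd D" and sol1: "pos_sol4 D x1 y1"
    and min: "\<And>x y. pos_sol4 D x y \<Longrightarrow> y1 \<le> y"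
    and sol: "pos_sol4 D x y"
  shows "\<exists>k>0. x = lucas_V x1 k \<and> y = y1 * lucas_U x1 k"
  using sol
proof (induction "nat y" arbitrary: x y rule: less_induct)
  case less
  have x1: "x1 > 0" "y1 > 0" "x1\<^sup>2 = 4 + D * y1\<^sup>2" using sol1 by (auto simp: pos_sol4_def)
  have xy: "x > 0" "y > 0" "x\<^sup>2 = 4 + D * y\<^sup>2" using less.prems by (auto simp: pos_sol4_def)
  show ?case
  proof (cases "y = y1")
    case True
    then have "x\<^sup>2 = x1\<^sup>2" using x1(3) xy(3) by simp
    then have "x = x1" using x1(1) xy(1) by (simp add: power2_eq_iff)
    then show ?thesis using True by (intro exI[of _ 1]) auto
  next
    case False
    then have y: "y1 < y" using min[OF less.prems] by simp
    \<comment> \<open>For odd D both coordinates of a solution have the same parity; this makes the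
      quotient integral.\<close>
    have par: "even u \<longleftrightarrow> even v" if "u\<^sup>2 = 4 + D * v\<^sup>2" for u v :: int
    proof -
      have "even (u\<^sup>2) \<longleftrightarrow> even (4 + D * v\<^sup>2)" using that by simp
      then show ?thesis using D(2) by simp
    qed
    have "even (x * x1 - D * y * y1)" "even (y * x1 - x * y1)"
      using par[OF x1(3)] par[OF xy(3)] D(2) by auto
    \<comment> \<open>(u + v sqrt D)/2 is the quotient of (x + y sqrt D)/2 by (x1 + y1 sqrt
      D)/2.\<close>
    then obtain u v where u: "x * x1 - D * y * y1 = 2 * u" and v: "y * x1 - x * y1 = 2 * v"
      by blast
    have x_eq: "2 * x = x1 * u + D * y1 * v"
    proof -
      have "2 * (x1 * u + D * y1 * v) = x1 * (x * x1 - D * y * y1) + D * y1 * (y * x1 - x * y1)"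
        unfolding u v by (simp add: algebra_simps)
      also have "\<dots> = x * (x1\<^sup>2 - D * y1\<^sup>2)" by (simp add: algebra_simps power2_eq_square)
      finally show ?thesis using x1(3) by simp
    qed
    have y_eq: "2 * y = x1 * v + y1 * u"
    proof -
      have "2 * (x1 * v + y1 * u) = x1 * (y * x1 - x * y1) + y1 * (x * x1 - D * y * y1)"
        unfolding u v by (simp add: algebra_simps)
      also have "\<dots> = y * (x1\<^sup>2 - D * y1\<^sup>2)" by (simp add: algebra_simps power2_eq_square)
      finally show ?thesis using x1(3) by simp
    qed
    have norm: "u\<^sup>2 - D * v\<^sup>2 = 4"
    proof -
      have "4 * (u\<^sup>2 - D * v\<^sup>2) = (2 * u)\<^sup>2 - D * (2 * v)\<^sup>2" by (simp add: power_mult_distrib algebra_simps)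
      also have "\<dots> = (x\<^sup>2 - D * y\<^sup>2) * (x1\<^sup>2 - D * y1\<^sup>2)"
        unfolding u[symmetric] v[symmetric] by (simp add: algebra_simps power2_eq_square)
      finally show ?thesis using x1(3) xy(3) by simp
    qed
    have "(x * y1)\<^sup>2 < (y * x1)\<^sup>2"
    proof -
      have "(y * x1)\<^sup>2 - (x * y1)\<^sup>2 = 4 * (y\<^sup>2 - y1\<^sup>2)"
        unfolding power_mult_distrib x1(3) xy(3) by (simp add: algebra_simps)
      moreover have "y1\<^sup>2 < y\<^sup>2" using y x1(2) by (simp add: power_strict_mono)
      ultimately have "(y * x1)\<^sup>2 - (x * y1)\<^sup>2 > 0" by simp
      then show ?thesis by (simp only: diff_gt_0_iff_gt)
    qed
    then have "x * y1 < y * x1" using xy x1 by (simp add: power_less_imp_less_base)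
    then have vpos: "v > 0" using v by linarith
    have x1_gt: "x1 > 2"
    proof (rule ccontr)
      assume "\<not> x1 > 2"
      then have "x1\<^sup>2 \<le> 2\<^sup>2" using x1(1) by (intro power_mono) auto
      moreover have "D * y1\<^sup>2 > 0" using D(1) x1(2) by simp
      ultimately show False using x1(3) by simp
    qed
    have "(D * y * y1)\<^sup>2 < (x * x1)\<^sup>2"
    proof -
      have "(x * x1)\<^sup>2 = (D * y * y1)\<^sup>2 + 16 + 4 * (D * y\<^sup>2) + 4 * (D * y1\<^sup>2)"
        unfolding power_mult_distrib x1(3) xy(3) by (simp add: algebra_simps power2_eq_square)
      moreover have "D * y1\<^sup>2 > 0" "D * y\<^sup>2 > 0" using D(1) x1(2) xy(2) by simp_all
      ultimately show ?thesis by linarith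
    qed
    then have "D * y * y1 < x * x1" using xy x1 by (simp add: power_less_imp_less_base)
    then have upos: "u > 0" using u by linarith
    have "x1 * v < 2 * y" using y_eq upos x1(2) by simp
    moreover have "2 * v < x1 * v" using x1_gt vpos by simp
    ultimately have "v < y" by linarith
    then obtain k where k: "k > 0" "u = lucas_V x1 k" "v = y1 * lucas_U x1 k"
      using less.hyps[of v u] vpos upos norm by (auto simp: pos_sol4_def)
    have "2 * x = 2 * lucas_V x1 (Suc k)"
      unfolding x_eq lucas_step k x1(3) by (simp add: algebra_simps power2_eq_square)
    moreover have "2 * y = y1 * (2 * lucas_U x1 (Suc k))"
      unfolding y_eq lucas_step k by (simp add: algebra_simps)
    ultimately show ?thesis by (intro exI[of _ "Suc k"]) auto
  qed
qed

section \<open>Return to powers of \<open>\<epsilon> / 2\<close>\<close>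

lemma of_int_lucas:
  "of_int (lucas_U x n) = lucas_U (of_int x) n" "of_int (lucas_V x n) = lucas_V (of_int x) n"
  by (induction x n rule: lucas_U.induct) auto

text \<open>(x + t)/2 is a root of X^2 - x X + 1; the lemma is applied with t = y1 sqrt D.\<close>

lemma lucas_power:
  fixes x t :: "'a::field_char_0"
  assumes "t\<^sup>2 = x\<^sup>2 - 4"
  shows "((x + t) / 2) ^ n = (lucas_V x n + t * lucas_U x n) / 2"
proof (induction n)
  case (Suc n)
  have "4 * ((x + t) / 2) ^ Suc n = (x + t) * (lucas_V x n + t * lucas_U x n)"
    by (simp add: Suc)
  also have "\<dots> = (x * lucas_V x n + t\<^sup>2 * lucas_U x n) + t * (x * lucas_U x n + lucas_V x n)"
    by (simp add: algebra_simps power2_eq_square)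
  also have "\<dots> = 2 * lucas_V x (Suc n) + t * (2 * lucas_U x (Suc n))"
    unfolding lucas_step assms ..
  finally have "2 * (2 * ((x + t) / 2) ^ Suc n) = 2 * (lucas_V x (Suc n) + t * lucas_U x (Suc n))"
    by (simp add: algebra_simps del: power_Suc)
  then have "2 * ((x + t) / 2) ^ Suc n = lucas_V x (Suc n) + t * lucas_U x (Suc n)"
    using mult_left_cancel[of "2 :: 'a"] by fastforce
  then show ?case by (simp add: eq_divide_eq mult.commute del: power_Suc)
qed auto

theorem theorem3p9:
  fixes D x1 y1 x y y' p :: int and n :: nat and \<epsilon> :: real
  assumes "D > 0" and "\<not> is_square D"
    and "\<exists>u v :: int. odd u \<and> odd v \<and> u\<^sup>2 - D * v\<^sup>2 = 4"
    and "min_pos_sol4 D x1 y1"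
    and "\<epsilon> = real_of_int x1 + real_of_int y1 * sqrt (real_of_int D)"
    and "pos_sol4 D x y"
    and "prime p" and "\<not> p dvd D" and "n > 0" and "y' > 0" and "y = p ^ n * y'"
    and "\<forall>q. prime q \<longrightarrow> q dvd y' \<longrightarrow> q dvd D"
    and "(x, y, D) \<noteq> (123, 55, 5)"
  shows "(real_of_int x + real_of_int y * sqrt (real_of_int D)) / 2
           \<in> {\<epsilon> / 2, (\<epsilon> / 2)\<^sup>2, (\<epsilon> / 2) ^ 3}"
proof -
  have sol1: "x1 > 0" "y1 > 0" "x1\<^sup>2 - D * y1\<^sup>2 = 4"
    using assms(4) by (auto simp: min_pos_sol4_def pos_sol4_def)
  obtain u v :: int where uv: "odd u" "odd v" "u\<^sup>2 - D * v\<^sup>2 = 4" using assms(3) by blast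
  obtain a b where a: "u = 2 * a + 1" and b: "v = 2 * b + 1" using uv by (elim oddE)
  have "D = 4 * (a\<^sup>2 + a - D * (b\<^sup>2 + b) - 1) + 1"
    using uv(3) unfolding a b by (simp add: algebra_simps power2_eq_square)
  then have D4: "D mod 4 = 1" by presburger
  then have oddD: "odd D" by presburger
  \<comment> \<open>Minimality of x + y sqrt D passes to y alone, since a smaller y in a positive
    solution forces a smaller x.\<close>
  have min: "y1 \<le> w" if "pos_sol4 D z w" for z w
  proof (rule ccontr)
    assume "\<not> y1 \<le> w"
    then have less: "w < y1" by simp
    have zw: "z > 0" "w > 0" "z\<^sup>2 - D * w\<^sup>2 = 4" using that by (auto simp: pos_sol4_def)
    have "w\<^sup>2 < y1\<^sup>2" using less zw(2) by (simp add: power_strict_mono)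
    then have "D * w\<^sup>2 < D * y1\<^sup>2" using assms(1) by simp
    then have "z\<^sup>2 < x1\<^sup>2" using zw sol1 by linarith
    then have "z < x1" using sol1 by (simp add: power_less_imp_less_base)
    then have "real_of_int z < real_of_int x1" by simp
    moreover have "real_of_int w * sqrt (real_of_int D) \<le> real_of_int y1 * sqrt (real_of_int D)"
      using less assms(1) by (intro mult_right_mono) auto
    ultimately show False using assms(4) that by (fastforce simp: min_pos_sol4_def)
  qed
  have s1: "pos_sol4 D x1 y1" using assms(4) by (simp add: min_pos_sol4_def)
  obtain k where k: "k > 0" "x = lucas_V x1 k" "y = y1 * lucas_U x1 k"
    using pos_sol4_lucas[OF assms(1) oddD s1 _ assms(6)] min by metis
  have Dy: "D * y1\<^sup>2 > 0" using assms(1) sol1(2) by simp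
  have x1: "x1 \<ge> 3"
  proof (rule ccontr)
    assume "\<not> x1 \<ge> 3"
    then have "x1\<^sup>2 \<le> 2\<^sup>2" using sol1(1) by (intro power_mono) auto
    then show False using Dy sol1(3) by simp
  qed
  have primes: "r = p \<or> r dvd D" if "prime r" "r dvd y1 * lucas_U x1 k" for r
  proof -
    have "r dvd p ^ n * y'" using that(2) k(3) assms(11) by simp
    then have "r dvd p \<or> r dvd y'" using that(1) by (meson prime_dvd_multD prime_dvd_power)
    then show ?thesis using that(1) assms(7,12) primes_dvd_imp_eq by blast
  qed
  have "k \<le> 3"
  proof (rule ccontr)
    assume "\<not> k \<le> 3"
    then have k5: "k = 5" and x3: "x1 = 3"
      using index_le_3[OF x1 sol1(3) D4 k(1) assms(7) primes] by auto
    \<comment> \<open>As D is not 1, this leaves D = 5 and y1 = 1, and index 5 gives the excluded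
      solution.\<close>
    have D5: "D * y1\<^sup>2 = 5" using sol1(3) x3 by simp
    have "y1 = 1"
    proof (rule ccontr)
      assume "y1 \<noteq> 1"
      then have "y1\<^sup>2 \<ge> 2\<^sup>2" using sol1(2) by (intro power_mono) auto
      moreover have "D \<noteq> 1" using assms(2) by auto
      then have "D \<ge> 2" using assms(1) by linarith
      ultimately have "D * y1\<^sup>2 \<ge> 2 * 4" by (intro mult_mono) auto
      then show False using D5 by simp
    qed
    then have "D = 5" using D5 by simp
    moreover have "x = 123" "y = 55"
      using k k5 x3 \<open>y1 = 1\<close> by (simp_all add: numeral_eq_Suc)
    ultimately show False using assms(13) by simp
  qed
  then have "k \<in> {1, 2, 3}" using k(1) by auto
  moreover have "(real_of_int x + real_of_int y * sqrt (real_of_int D)) / 2 = (\<epsilon> / 2) ^ k"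
  proof -
    let ?t = "real_of_int y1 * sqrt (real_of_int D)"
    have "x1\<^sup>2 - 4 = D * y1\<^sup>2" using sol1(3) by simp
    then have "real_of_int (x1\<^sup>2 - 4) = real_of_int (D * y1\<^sup>2)" by (simp only:)
    then have "?t\<^sup>2 = (real_of_int x1)\<^sup>2 - 4" using assms(1) by (simp add: power_mult_distrib)
    from lucas_power[OF this] show ?thesis
      unfolding assms(5) k by (simp add: of_int_lucas mult_ac)
  qed
  ultimately show ?thesis by auto
qed

end
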